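(* Let $k$ be an algebraically closed field of characteristic zero, $n\ge 1$, $B=k[x_1,\dots,x_n]$, $D$ a locally nilpotent $k$-derivation of $B$, $A=\ker D$, and $N\in\mathbb{Z}\setminus\{0\}$. Let $s$ and $s'=s+a$ with $a\in A$ be two slices of $D$, and let $\partial=NsD$, $\partial'=Ns'D$. Then $$\phi_a\circ\partial\circ\phi_a^{-1}=\partial',\qquad\text{where }\phi_a:=\exp(aD)\in\operatorname{Aut}_k(B).$$ In particular, the linearizability of the associated $\mathbb{G}_{\mathrm m}$-action does not depend on the choice of slice: the $\mathbb{G}_{\mathrm m}$-action defined by $\partial$ is linearizable if and only if the one defined by $\partial'$ is.
   Context: A $k$-derivation $D$ of $B$ is locally nilpotent if for every $b\in B$ there is $m\ge1$ with $D^m(b)=0$. A slice of $D$ is an element $s\in B$ with $D(s)=1$; any two slices differ by an element of $A$. For $a\in A$, $\exp(aD)(b)=\sum_{j\ge0}\frac{a^j}{j!}D^j(b)$. For a slice $s$, $B=A[s]$ is a polynomial ring over $A$, and the derivation $NsD$ defines the $\mathbb{G}_{\mathrm m}$-action $\alpha_t(P(s))=P(t^Ns)$, $P\in A[T]$, $t\in k^*$. This action is called linearizable if there exists $\phi\in\operatorname{Aut}_k(B)$ such that $\phi (NsD)\phi^{-1}$ is a diagonal linear derivation $\sum_i\lambda_ix_i\frac{\partial}{\partial x_i}$, $\lambda_i\in k$. *)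

theory Defs
  imports
    "HOL-Library.Poly_Mapping"
    "HOL-Computational_Algebra.Polynomial"
begin

text \<open>
  Polynomials over \<open>'k\<close> in the variables \<open>x\<^sub>i\<close>, \<open>i :: 'n\<close>: finitely supported maps from monomials
  (exponent vectors) to coefficients. The ring structure on this type is the one of
  \<open>Poly_Mapping\<close>; with \<open>'n\<close> finite it is the polynomial ring in \<open>CARD('n) \<ge> 1\<close> variables.
\<close>

type_synonym ('n, 'k) mpoly = "('n \<Rightarrow>\<^sub>0 nat) \<Rightarrow>\<^sub>0 'k"

definition Const :: "'k \<Rightarrow> ('n, 'k::comm_ring_1) mpoly" where
  "Const c = Poly_Mapping.single 0 c"

definition Var :: "'n \<Rightarrow> ('n, 'k::comm_ring_1) mpoly" where
  "Var i = Poly_Mapping.single (Poly_Mapping.single i 1) 1"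

text \<open>
  For a monomial \<open>m\<close> not containing \<open>x\<^sub>i\<close> the truncated difference of exponents is harmless,
  since the coefficient is then \<open>0\<close>.
\<close>

definition partial_deriv :: "'n \<Rightarrow> ('n, 'k::comm_ring_1) mpoly \<Rightarrow> ('n, 'k) mpoly" where
  "partial_deriv i p =
     (\<Sum>m\<in>Poly_Mapping.keys p.
        Poly_Mapping.single (m - Poly_Mapping.single i 1)
          (of_nat (Poly_Mapping.lookup m i) * Poly_Mapping.lookup p m))"

definition alg_aut :: "(('n, 'k::comm_ring_1) mpoly \<Rightarrow> ('n, 'k) mpoly) \<Rightarrow> bool" where
  "alg_aut \<phi> \<longleftrightarrow> bij \<phi> \<and> (\<forall>p q. \<phi> (p + q) = \<phi> p + \<phi> q) \<and> (\<forall>p q. \<phi> (p * q) = \<phi> p * \<phi> q)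
     \<and> (\<forall>c. \<phi> (Const c) = Const c)"

definition derivation :: "(('n, 'k::comm_ring_1) mpoly \<Rightarrow> ('n, 'k) mpoly) \<Rightarrow> bool" where
  "derivation D \<longleftrightarrow> (\<forall>p q. D (p + q) = D p + D q) \<and> (\<forall>c p. D (Const c * p) = Const c * D p)
     \<and> (\<forall>p q. D (p * q) = D p * q + p * D q)"

definition locally_nilpotent_derivation ::
    "(('n, 'k::comm_ring_1) mpoly \<Rightarrow> ('n, 'k) mpoly) \<Rightarrow> bool" where
  "locally_nilpotent_derivation D \<longleftrightarrow> derivation D \<and> (\<forall>b. \<exists>m\<ge>1. (D ^^ m) b = 0)"

definition ker_der :: "(('n, 'k::comm_ring_1) mpoly \<Rightarrow> ('n, 'k) mpoly) \<Rightarrow> ('n, 'k) mpoly set" where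
  "ker_der D = {b. D b = 0}"

definition is_slice ::
    "(('n, 'k::comm_ring_1) mpoly \<Rightarrow> ('n, 'k) mpoly) \<Rightarrow> ('n, 'k) mpoly \<Rightarrow> bool" where
  "is_slice D s \<longleftrightarrow> D s = 1"

text \<open>\<open>Sum_any\<close> sums over the \<open>j\<close> with nonzero summand, a finite set when \<open>D\<close> is locally nilpotent.\<close>

definition exp_derivation ::
    "('n, 'k::field_char_0) mpoly \<Rightarrow> (('n, 'k) mpoly \<Rightarrow> ('n, 'k) mpoly) \<Rightarrow> ('n, 'k) mpoly \<Rightarrow> ('n, 'k) mpoly" where
  "exp_derivation a D b = Sum_any (\<lambda>j. Const (1 / fact j) * a ^ j * (D ^^ j) b)"

definition scaled_derivation ::
    "int \<Rightarrow> (('n, 'k::comm_ring_1) mpoly \<Rightarrow> ('n, 'k) mpoly) \<Rightarrow> ('n, 'k) mpoly \<Rightarrow> ('n, 'k) mpoly \<Rightarrow> ('n, 'k) mpoly" where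
  "scaled_derivation N D s = (\<lambda>b. of_int N * s * D b)"

definition diagonal_linear :: "(('n::finite, 'k::comm_ring_1) mpoly \<Rightarrow> ('n, 'k) mpoly) \<Rightarrow> bool" where
  "diagonal_linear \<delta> \<longleftrightarrow>
     (\<exists>l :: 'n \<Rightarrow> 'k. \<forall>p. \<delta> p = (\<Sum>i\<in>UNIV. Const (l i) * Var i * partial_deriv i p))"

text \<open>
  The map sending \<open>P(s)\<close> to \<open>P(t\<^sup>N s)\<close> for every polynomial \<open>P\<close> with coefficients in the kernel
  of \<open>D\<close>; see \<open>gm_action_poly\<close> below for well-definedness. Only \<open>t \<noteq> 0\<close> is meaningful.
\<close>

definition gm_action ::
    "int \<Rightarrow> (('n, 'k::field) mpoly \<Rightarrow> ('n, 'k) mpoly) \<Rightarrow> ('n, 'k) mpoly \<Rightarrow> 'k \<Rightarrow> ('n, 'k) mpoly \<Rightarrow> ('n, 'k) mpoly" where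
  "gm_action N D s t b =
     (THE c. \<exists>P. (\<forall>i. coeff P i \<in> ker_der D) \<and> b = poly P s \<and> c = poly P (Const (t powi N) * s))"

text \<open>
  An action \<open>\<alpha>\<close> is a function of \<open>t\<close> that may occur as the action of several triples \<open>(N, D, s)\<close>;
  they all have the same derivation \<open>NsD\<close>, so linearizability does not depend on the triple
  (see \<open>gm_linearizable_iff\<close> below).
\<close>

definition gm_linearizable ::
    "('k::field \<Rightarrow> ('n::finite, 'k) mpoly \<Rightarrow> ('n, 'k) mpoly) \<Rightarrow> bool" where
  "gm_linearizable \<alpha> \<longleftrightarrow>
     (\<exists>N D s. N \<noteq> 0 \<and> locally_nilpotent_derivation D \<and> is_slice D s
        \<and> (\<forall>t. t \<noteq> 0 \<longrightarrow> \<alpha> t = gm_action N D s t)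
        \<and> (\<exists>\<phi>. alg_aut \<phi> \<and> diagonal_linear (\<phi> \<circ> scaled_derivation N D s \<circ> inv \<phi>)))"


section \<open>Well-definedness\<close>

lemma lookup_Const_mult:
  "Poly_Mapping.lookup (Const c * p) m = c * Poly_Mapping.lookup p m"
  by (simp add: Const_def lookup_mult lookup_single when_mult)

lemma Const_mult: "Const c * Const d = Const (c * d)"
  by (simp add: Const_def mult_single)

lemma Const_1 [simp]: "Const 1 = 1"
  by (simp add: Const_def)

lemma Const_of_nat: "Const (of_nat n) = of_nat n"
  by (simp add: Const_def)

lemma Const_of_int: "Const (of_int n) = of_int n"
  by (simp add: Const_def)

lemma Const_power: "Const c ^ n = Const (c ^ n)"
  by (induction n) (simp_all add: Const_mult)

lemma derivationD:
  assumes "derivation D"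
  shows "D (p + q) = D p + D q" "D (Const c * p) = Const c * D p" "D (p * q) = D p * q + p * D q"
    "D 0 = 0" "D 1 = 0" "D (Const c) = 0" "D (p - q) = D p - D q" "D (sum f X) = (\<Sum>x\<in>X. D (f x))"
proof -
  note d = assms[unfolded derivation_def]
  show add: "D (p + q) = D p + D q" and sc: "D (Const c * p) = Const c * D p"
    and mu: "D (p * q) = D p * q + p * D q" for p q c
    using d by blast+
  have z: "D 0 = 0" using add[of 0 0] by simp
  then show "D 0 = 0" .
  have o: "D 1 = 0" using mu[of 1 1] by simp
  then show "D 1 = 0" .
  show "D (Const c) = 0" using sc[of c 1] o by simp
  show "D (p - q) = D p - D q" using add[of "p - q" q] by simp
  show "D (sum f X) = (\<Sum>x\<in>X. D (f x))"
    by (induction X rule: infinite_finite_induct) (simp_all add: z add)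
qed

lemma derivation_slice_power:
  assumes "derivation D" "is_slice D s" "c \<in> ker_der D"
  shows "D (c * s ^ Suc i) = c * of_nat (Suc i) * s ^ i"
proof -
  have "D (s ^ Suc i) = of_nat (Suc i) * s ^ i"
  proof (induction i)
    case 0
    then show ?case using assms by (simp add: is_slice_def)
  next
    case (Suc i)
    have "D (s ^ Suc (Suc i)) = D s * s ^ Suc i + s * D (s ^ Suc i)"
      using derivationD(3)[OF assms(1), of s "s ^ Suc i"] by simp
    then show ?case
      using assms(2) unfolding Suc by (simp add: is_slice_def algebra_simps)
  qed
  then show ?thesis
    using assms derivationD(3)[OF assms(1), of c "s ^ Suc i"]
    by (simp add: ker_der_def mult.assoc)
qed

lemma kernel_mult_Const: "derivation D \<Longrightarrow> c \<in> ker_der D \<Longrightarrow> c * Const x \<in> ker_der D"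
  using derivationD(2)[of D x c] by (simp add: ker_der_def mult.commute)

lemma funpow_derivation_slice_power:
  assumes "derivation D" "is_slice D s" "c \<in> ker_der D"
  shows "(D ^^ i) (c * s ^ i) = c * Const (of_nat (fact i))"
    and "(D ^^ Suc i) (c * s ^ i) = 0"
proof -
  show A: "(D ^^ i) (c * s ^ i) = c * Const (of_nat (fact i))"
    using assms(3)
  proof (induction i arbitrary: c)
    case (Suc i)
    have k: "c * of_nat (Suc i) \<in> ker_der D"
      using kernel_mult_Const[OF assms(1) Suc.prems, of "of_nat (Suc i)"]
      by (simp only: Const_of_nat)
    have "(D ^^ Suc i) (c * s ^ Suc i) = (D ^^ i) (D (c * s ^ Suc i))"
      by (simp only: funpow_Suc_right o_apply)
    also have "\<dots> = (D ^^ i) (c * of_nat (Suc i) * s ^ i)"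
      by (simp only: derivation_slice_power[OF assms(1,2) Suc.prems])
    also have "\<dots> = c * of_nat (Suc i) * Const (of_nat (fact i))"
      by (rule Suc.IH[OF k])
    also have "\<dots> = c * Const (of_nat (fact (Suc i)))"
      by (simp only: Const_mult[symmetric] Const_of_nat fact_Suc of_nat_mult of_nat_id mult.assoc)
    finally show ?case .
  qed (simp add: Const_def)
  show "(D ^^ Suc i) (c * s ^ i) = 0"
    using kernel_mult_Const[OF assms(1,3), of "of_nat (fact i)"] A by (simp add: ker_der_def)
qed

lemma funpow_derivation_zero: "derivation D \<Longrightarrow> (D ^^ j) 0 = 0"
  by (induction j) (simp_all add: derivationD)

lemma funpow_derivation_sum: "derivation D \<Longrightarrow> (D ^^ j) (sum f X) = (\<Sum>x\<in>X. (D ^^ j) (f x))"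
  by (induction j) (simp_all add: derivationD)

lemma kernel_poly_eq_0:
  fixes D :: "('n, 'k::field_char_0) mpoly \<Rightarrow> ('n, 'k) mpoly"
  assumes "derivation D" "is_slice D s" "\<And>i. coeff P i \<in> ker_der D" "poly P s = 0"
  shows "P = 0"
proof -
  let ?d = "degree P"
  have van: "(D ^^ ?d) (coeff P i * s ^ i) = 0" if "i < ?d" for i
  proof -
    have "(D ^^ (?d - Suc i + Suc i)) (coeff P i * s ^ i) = 0"
      unfolding funpow_add o_apply
      by (simp only: funpow_derivation_slice_power(2)[OF assms(1-3)] funpow_derivation_zero[OF assms(1)])
    moreover have "?d - Suc i + Suc i = ?d" using that by simp
    ultimately show ?thesis by (simp only:)
  qed
  have "0 = (D ^^ ?d) (poly P s)"
    using assms(4) funpow_derivation_zero[OF assms(1)] by simp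
  also have "\<dots> = (\<Sum>i\<le>?d. (D ^^ ?d) (coeff P i * s ^ i))"
    by (simp add: poly_altdef funpow_derivation_sum[OF assms(1)])
  also have "\<dots> = (D ^^ ?d) (coeff P ?d * s ^ ?d)"
    using van by (subst sum.remove[of _ ?d]) auto
  also have "\<dots> = coeff P ?d * Const (of_nat (fact ?d))"
    by (rule funpow_derivation_slice_power[OF assms(1-3)])
  finally have "coeff P ?d * Const (of_nat (fact ?d)) * Const (inverse (of_nat (fact ?d))) = 0"
    by simp
  then have "coeff P ?d = 0"
    by (simp only: mult.assoc Const_mult) simp
  then show ?thesis by simp
qed

lemma kernel_poly_exists:
  fixes D :: "('n, 'k::field_char_0) mpoly \<Rightarrow> ('n, 'k) mpoly"
  assumes "locally_nilpotent_derivation D" "is_slice D s"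
  shows "\<exists>P. (\<forall>i. coeff P i \<in> ker_der D) \<and> b = poly P s"
proof -
  have der: "derivation D" using assms(1) by (simp add: locally_nilpotent_derivation_def)
  have "\<exists>P. (\<forall>i. coeff P i \<in> ker_der D) \<and> b = poly P s" if "(D ^^ m) b = 0" for m b
    using that
  proof (induction m arbitrary: b)
    case 0
    then show ?case by (intro exI[of _ 0]) (simp add: ker_der_def derivationD[OF der])
  next
    case (Suc m)
    have "(D ^^ m) (D b) = 0"
      using Suc.prems by (simp only: funpow_Suc_right o_apply)
    from Suc.IH[OF this] obtain P where P: "\<And>i. coeff P i \<in> ker_der D" "D b = poly P s" by blast
    define q where "q i = coeff P i * Const (inverse (of_nat (Suc i)))" for i
    have q: "q i \<in> ker_der D" for i
      unfolding q_def by (rule kernel_mult_Const[OF der P(1)])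
    have Dq: "D (q i * s ^ Suc i) = coeff P i * s ^ i" for i
    proof -
      have "q i * of_nat (Suc i) = coeff P i"
        unfolding q_def Const_of_nat[symmetric, of "Suc i"] mult.assoc Const_mult
        by (simp add: field_simps del: of_nat_Suc)
      then show ?thesis
        by (simp only: derivation_slice_power[OF der assms(2) q])
    qed
    define Q where "Q = (\<Sum>i\<le>degree P. monom (q i) (Suc i))"
    define c where "c = b - poly Q s"
    have "poly Q s = (\<Sum>i\<le>degree P. q i * s ^ Suc i)"
      unfolding Q_def poly_sum poly_monom ..
    then have "D (poly Q s) = poly P s"
      by (simp only: derivationD(8)[OF der] Dq poly_altdef)
    then have c: "c \<in> ker_der D"
      using P by (simp add: ker_der_def c_def derivationD[OF der])
    have "coeff (Q + [:c:]) i \<in> ker_der D" for i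
    proof -
      have "coeff Q i \<in> ker_der D"
        using q unfolding Q_def coeff_sum
        by (auto simp: ker_der_def derivationD[OF der] intro!: sum.neutral)
      then show ?thesis using c
        by (cases i) (auto simp: ker_der_def derivationD[OF der])
    qed
    moreover have "b = poly (Q + [:c:]) s" by (simp add: c_def)
    ultimately show ?case by blast
  qed
  moreover obtain m where "(D ^^ m) b = 0"
    using assms(1) by (auto simp: locally_nilpotent_derivation_def)
  ultimately show ?thesis by blast
qed

lemma gm_action_poly:
  fixes D :: "('n, 'k::field_char_0) mpoly \<Rightarrow> ('n, 'k) mpoly"
  assumes "derivation D" "is_slice D s" "\<And>i. coeff P i \<in> ker_der D"
  shows "gm_action N D s t (poly P s) = poly P (Const (t powi N) * s)"
  unfolding gm_action_def
proof (rule the_equality)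
  show "\<exists>Q. (\<forall>i. coeff Q i \<in> ker_der D) \<and> poly P s = poly Q s \<and>
      poly P (Const (t powi N) * s) = poly Q (Const (t powi N) * s)"
    using assms(3) by blast
next
  fix c
  assume "\<exists>Q. (\<forall>i. coeff Q i \<in> ker_der D) \<and> poly P s = poly Q s \<and> c = poly Q (Const (t powi N) * s)"
  then obtain Q where Q: "\<And>i. coeff Q i \<in> ker_der D" "poly P s = poly Q s"
    "c = poly Q (Const (t powi N) * s)" by blast
  have "P - Q = 0"
    using assms Q by (intro kernel_poly_eq_0[OF assms(1,2)])
      (simp_all add: ker_der_def derivationD[OF assms(1)])
  then show "c = poly P (Const (t powi N) * s)" using Q(3) by simp
qed

lemma laurent_weighted_sum_eq:
  fixes x y :: "nat \<Rightarrow> 'k::field_char_0" and N N' :: int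
  assumes "\<And>t. t \<noteq> 0 \<Longrightarrow> (\<Sum>i\<le>d. x i * t powi (N * int i)) = (\<Sum>j\<le>e. y j * t powi (N' * int j))"
  shows "(\<Sum>i\<le>d. of_int (N * int i) * x i) = (\<Sum>j\<le>e. of_int (N' * int j) * y j)"
proof -
  define M where "M = \<bar>N\<bar> * int d + \<bar>N'\<bar> * int e"
  have M0: "0 \<le> N * int i + M" if "i \<le> d" for i
  proof -
    have "\<bar>N * int i\<bar> \<le> \<bar>N\<bar> * int d" using that by (simp add: abs_mult mult_left_mono)
    moreover have "0 \<le> \<bar>N'\<bar> * int e" by simp
    ultimately show ?thesis unfolding M_def by linarith
  qed
  have M1: "0 \<le> N' * int i + M" if "i \<le> e" for i
  proof -
    have "\<bar>N' * int i\<bar> \<le> \<bar>N'\<bar> * int e" using that by (simp add: abs_mult mult_left_mono)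
    moreover have "0 \<le> \<bar>N\<bar> * int d" by simp
    ultimately show ?thesis unfolding M_def by linarith
  qed
  define p where "p = (\<Sum>i\<le>d. monom (x i) (nat (N * int i + M)))
    - (\<Sum>j\<le>e. monom (y j) (nat (N' * int j + M)))"
  have pow: "t ^ nat (u + M) = t powi u * t powi M" if "0 \<le> u + M" "t \<noteq> 0" for t :: 'k and u
  proof -
    have "t ^ nat (u + M) = t powi (u + M)" using that(1) by (simp add: power_int_def)
    also have "\<dots> = t powi u * t powi M" using that(2) by (intro power_int_add) simp
    finally show ?thesis .
  qed
  have "poly p t = 0" if "t \<noteq> 0" for t
  proof -
    have "poly p t = (\<Sum>i\<le>d. x i * t powi (N * int i)) * t powi M
        - (\<Sum>j\<le>e. y j * t powi (N' * int j)) * t powi M"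
      unfolding p_def poly_diff poly_sum poly_monom sum_distrib_right mult.assoc
      by (intro arg_cong2[where f = "(-)"] sum.cong refl arg_cong2[where f = "(*)"])
        (simp_all only: pow M0 M1 that atMost_iff not_False_eq_True)
    then show ?thesis using assms[OF that] by simp
  qed
  then have "poly (p * [:0, 1:]) t = 0" for t by (cases "t = 0") auto
  then have "p * [:0, 1:] = 0" using poly_all_0_iff_0 by blast
  then have "p = 0" by simp
  have pderiv_sum: "pderiv (sum f X) = (\<Sum>x\<in>X. pderiv (f x))" for f :: "nat \<Rightarrow> 'k poly" and X
    by (induction X rule: infinite_finite_induct) (simp_all add: pderiv_add)
  from \<open>p = 0\<close> have "0 = poly (pderiv p) 1" by simp
  also have "\<dots> = (\<Sum>i\<le>d. of_nat (nat (N * int i + M)) * x i)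
      - (\<Sum>j\<le>e. of_nat (nat (N' * int j + M)) * y j)"
    unfolding p_def by (simp add: pderiv_diff pderiv_sum poly_sum pderiv_monom poly_monom)
  also have "\<dots> = (\<Sum>i\<le>d. of_int (N * int i) * x i + of_int M * x i)
      - (\<Sum>j\<le>e. of_int (N' * int j) * y j + of_int M * y j)"
    by (intro arg_cong2[where f = "(-)"] sum.cong refl)
      (simp_all only: of_nat_nat M0 M1 atMost_iff of_int_add distrib_right)
  also have "\<dots> = (\<Sum>i\<le>d. of_int (N * int i) * x i) - (\<Sum>j\<le>e. of_int (N' * int j) * y j)
      + of_int M * ((\<Sum>i\<le>d. x i) - (\<Sum>j\<le>e. y j))"
    by (simp add: sum.distrib sum_distrib_left algebra_simps)
  also have "(\<Sum>i\<le>d. x i) - (\<Sum>j\<le>e. y j) = 0" using assms[of 1] by simp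
  finally show ?thesis by simp
qed

lemma lookup_gm_action:
  fixes D :: "('n, 'k::field_char_0) mpoly \<Rightarrow> ('n, 'k) mpoly"
  assumes "derivation D" "is_slice D s" "\<And>i. coeff P i \<in> ker_der D"
  shows "Poly_Mapping.lookup (gm_action N D s t (poly P s)) m =
    (\<Sum>i\<le>degree P. Poly_Mapping.lookup (coeff P i * s ^ i) m * t powi (N * int i))"
proof -
  have "coeff P i * (Const (t powi N) * s) ^ i = Const (t powi (N * int i)) * (coeff P i * s ^ i)" for i
    by (simp add: power_mult_distrib Const_power power_int_mult mult_ac)
  then show ?thesis
    unfolding gm_action_poly[OF assms] unfolding poly_altdef
    by (simp only: lookup_sum lookup_Const_mult mult.commute[of "Poly_Mapping.lookup _ _"])
qed

lemma lookup_scaled_derivation: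
  fixes D :: "('n, 'k::field_char_0) mpoly \<Rightarrow> ('n, 'k) mpoly"
  assumes "derivation D" "is_slice D s" "\<And>i. coeff P i \<in> ker_der D"
  shows "Poly_Mapping.lookup (scaled_derivation N D s (poly P s)) m =
    (\<Sum>i\<le>degree P. of_int (N * int i) * Poly_Mapping.lookup (coeff P i * s ^ i) m)"
proof -
  have t: "of_int N * s * D (coeff P i * s ^ i) = Const (of_int (N * int i)) * (coeff P i * s ^ i)" for i
  proof (cases i)
    case 0
    then show ?thesis using assms(3)[of 0] by (simp add: ker_der_def Const_def)
  next
    case (Suc j)
    have "of_int N * s * D (coeff P i * s ^ i) = of_int N * s * (coeff P i * of_nat (Suc j) * s ^ j)"
      unfolding Suc by (simp only: derivation_slice_power[OF assms])
    also have "\<dots> = of_int N * of_nat (Suc j) * (coeff P i * s ^ Suc j)"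
      by (simp only: power_Suc mult_ac)
    finally show ?thesis
      by (simp only: Suc Const_mult[symmetric] Const_of_int Const_of_nat of_int_mult of_int_of_nat_eq)
  qed
  show ?thesis
    by (simp only: scaled_derivation_def poly_altdef derivationD(8)[OF assms(1)] sum_distrib_left
        t lookup_sum lookup_Const_mult)
qed

lemma gm_action_determines_derivation:
  fixes D D' :: "('n, 'k::field_char_0) mpoly \<Rightarrow> ('n, 'k) mpoly"
  assumes "locally_nilpotent_derivation D" "is_slice D s"
    and "locally_nilpotent_derivation D'" "is_slice D' s'"
    and eq: "\<And>t. t \<noteq> 0 \<Longrightarrow> gm_action N D s t = gm_action N' D' s' t"
  shows "scaled_derivation N D s = scaled_derivation N' D' s'"
proof (intro ext poly_mapping_eqI)
  fix b m
  have der: "derivation D" "derivation D'"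
    using assms by (simp_all add: locally_nilpotent_derivation_def)
  obtain P where P: "\<And>i. coeff P i \<in> ker_der D" "b = poly P s"
    using kernel_poly_exists[OF assms(1,2)] by blast
  obtain Q where Q: "\<And>i. coeff Q i \<in> ker_der D'" "b = poly Q s'"
    using kernel_poly_exists[OF assms(3,4)] by blast
  have "(\<Sum>i\<le>degree P. Poly_Mapping.lookup (coeff P i * s ^ i) m * t powi (N * int i)) =
      (\<Sum>j\<le>degree Q. Poly_Mapping.lookup (coeff Q j * s' ^ j) m * t powi (N' * int j))"
    if "t \<noteq> 0" for t
    using lookup_gm_action[OF der(1) assms(2) P(1), of N t m]
      lookup_gm_action[OF der(2) assms(4) Q(1), of N' t m] eq[OF that] P(2) Q(2) by simp
  from laurent_weighted_sum_eq[OF this]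
  show "Poly_Mapping.lookup (scaled_derivation N D s b) m =
      Poly_Mapping.lookup (scaled_derivation N' D' s' b) m"
    using lookup_scaled_derivation[OF der(1) assms(2) P(1), of N m]
      lookup_scaled_derivation[OF der(2) assms(4) Q(1), of N' m] P(2) Q(2) by simp
qed

lemma gm_linearizable_iff:
  fixes D :: "('n::finite, 'k::field_char_0) mpoly \<Rightarrow> ('n, 'k) mpoly"
  assumes "N \<noteq> 0" "locally_nilpotent_derivation D" "is_slice D s"
  shows "gm_linearizable (gm_action N D s) \<longleftrightarrow>
    (\<exists>\<phi>. alg_aut \<phi> \<and> diagonal_linear (\<phi> \<circ> scaled_derivation N D s \<circ> inv \<phi>))"
proof
  assume "gm_linearizable (gm_action N D s)"
  then obtain N' D' s' \<phi> where *: "locally_nilpotent_derivation D'" "is_slice D' s'"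
    "\<And>t. t \<noteq> 0 \<Longrightarrow> gm_action N D s t = gm_action N' D' s' t"
    "alg_aut \<phi>" "diagonal_linear (\<phi> \<circ> scaled_derivation N' D' s' \<circ> inv \<phi>)"
    unfolding gm_linearizable_def by blast
  show "\<exists>\<phi>. alg_aut \<phi> \<and> diagonal_linear (\<phi> \<circ> scaled_derivation N D s \<circ> inv \<phi>)"
    using gm_action_determines_derivation[OF assms(2,3) *(1,2,3)] *(4,5) by metis
next
  assume "\<exists>\<phi>. alg_aut \<phi> \<and> diagonal_linear (\<phi> \<circ> scaled_derivation N D s \<circ> inv \<phi>)"
  then show "gm_linearizable (gm_action N D s)"
    using assms unfolding gm_linearizable_def by blast
qed

end

theory Submission
  imports Defs
begin

text \<open>
  Write \<open>A = ker D\<close>. A slice \<open>s\<close> makes \<open>B = A[s]\<close>, so every element of \<open>B\<close> is \<open>P(s)\<close> for a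
  polynomial \<open>P\<close> over \<open>A\<close>. In these coordinates \<open>D\<close> is differentiation, \<open>D (P(s)) = P'(s)\<close>
  (\<open>derivation_poly_slice\<close>), and by Taylor's formula its exponential is translation,
  \<open>exp(aD)(P(s)) = P(s + a)\<close> (\<open>exp_derivation_poly\<close>). Everything follows from this formula. Substituting \<open>s + a\<close>
  for \<open>s\<close> is a ring homomorphism that fixes \<open>A\<close>, hence the constants, and substituting
  \<open>s - a\<close> undoes it, so \<open>exp(aD)\<close> is an automorphism. Moreover \<open>NsD\<close> sends \<open>P(s)\<close> to the value
  of \<open>N T P'(T)\<close> at \<open>s\<close>; translating, that value becomes \<open>N (s + a) P'(s + a)\<close>, which is the image
  of \<open>P(s + a)\<close> under \<open>N (s + a) D\<close> because \<open>s + a\<close> is again a slice. So translation intertwines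
  \<open>NsD\<close> with \<open>N(s + a)D\<close>.

  An automorphism diagonalizing \<open>N(s + a)D\<close>, composed with \<open>exp(aD)\<close>, diagonalizes \<open>NsD\<close>. The
  converse is the same statement for the slice \<open>s + a\<close> and the kernel element \<open>-a\<close>.
\<close>

lemma ker_der_closed:
  assumes "derivation D"
  shows "x \<in> ker_der D \<Longrightarrow> y \<in> ker_der D \<Longrightarrow> x + y \<in> ker_der D"
    and "x \<in> ker_der D \<Longrightarrow> y \<in> ker_der D \<Longrightarrow> x * y \<in> ker_der D"
    and "x \<in> ker_der D \<Longrightarrow> - x \<in> ker_der D"
    and "(\<And>i. i \<in> I \<Longrightarrow> f i \<in> ker_der D) \<Longrightarrow> sum f I \<in> ker_der D"
    and "Const c \<in> ker_der D"
    and "of_nat n \<in> ker_der D"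
    and "of_int k \<in> ker_der D"
proof -
  show C: "Const c \<in> ker_der D" for c
    by (simp add: ker_der_def derivationD[OF assms])
  show "of_nat n \<in> ker_der D" "of_int k \<in> ker_der D"
    using C[of "of_nat n"] C[of "of_int k"] by (simp_all only: Const_of_nat Const_of_int)
  show "x \<in> ker_der D \<Longrightarrow> - x \<in> ker_der D"
    using derivationD(7)[OF assms, of 0 x] by (simp add: ker_der_def derivationD(4)[OF assms])
qed (auto simp: ker_der_def derivationD[OF assms])

lemma ker_der_poly_closed:
  assumes "derivation D" "\<And>i. coeff P i \<in> ker_der D" "\<And>i. coeff Q i \<in> ker_der D"
  shows "coeff (P + Q) i \<in> ker_der D" "coeff (P * Q) i \<in> ker_der D"
  using assms(2,3) by (auto simp: coeff_mult intro!: ker_der_closed(1,2,4)[OF assms(1)])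

lemma ker_der_pCons_closed:
  assumes "derivation D" "c \<in> ker_der D" "\<And>i. coeff P i \<in> ker_der D"
  shows "coeff (pCons c P) i \<in> ker_der D"
  using assms(2,3) by (simp add: coeff_pCons split: nat.split)

section \<open>Derivations in the coordinate given by a slice\<close>

text \<open>
  The polynomial \<open>Q\<close> is the derivative \<open>P'\<close>, built by the recursion \<open>(c + T P)' = P + T P'\<close>. The
  order of the quantifiers is what makes it useful: one \<open>Q\<close> serves every slice, so it can be
  evaluated at \<open>s\<close> and at \<open>s + a\<close>.
\<close>

lemma derivation_poly_slice:
  assumes "derivation D" "\<And>i. coeff P i \<in> ker_der D"
  shows "\<exists>Q. (\<forall>i. coeff Q i \<in> ker_der D) \<and> (\<forall>s. is_slice D s \<longrightarrow> D (poly P s) = poly Q s)"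
  using assms(2)
proof (induction P)
  case 0
  then show ?case by (intro exI[of _ 0]) (auto simp: derivationD[OF assms(1)])
next
  case (pCons c P)
  have c: "D c = 0" using pCons.prems[of 0] by (simp add: ker_der_def)
  have P: "coeff P i \<in> ker_der D" for i
    using pCons.prems[of "Suc i"] by simp
  then obtain Q where Q: "\<And>i. coeff Q i \<in> ker_der D"
    and DQ: "\<And>s. is_slice D s \<Longrightarrow> D (poly P s) = poly Q s"
    using pCons.IH by blast
  have "coeff (P + pCons 0 Q) i \<in> ker_der D" for i
    by (intro ker_der_poly_closed[OF assms(1)] ker_der_pCons_closed[OF assms(1)] P Q)
      (simp add: ker_der_def derivationD[OF assms(1)])
  moreover have "D (poly (pCons c P) s) = poly (P + pCons 0 Q) s" if "is_slice D s" for s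
    using that c DQ[OF that] by (simp add: derivationD[OF assms(1)] is_slice_def)
  ultimately show ?case by blast
qed

text \<open>
  For \<open>j > i\<close> the binomial coefficient vanishes, so the exponent truncated to \<open>0\<close> is harmless.
\<close>

lemma funpow_derivation_slice_monomial:
  assumes "derivation D" "is_slice D s" "c \<in> ker_der D"
  shows "(D ^^ j) (c * s ^ i) = of_nat (fact j * (i choose j)) * c * s ^ (i - j)"
proof (induction j)
  case (Suc j)
  have k: "of_nat (fact j * (i choose j)) * c \<in> ker_der D"
    by (intro ker_der_closed(2,6)[OF assms(1)] assms(3))
  have "(D ^^ Suc j) (c * s ^ i) = D (of_nat (fact j * (i choose j)) * c * s ^ (i - j))"
    using Suc by simp
  also have "\<dots> = of_nat (fact (Suc j) * (i choose Suc j)) * c * s ^ (i - Suc j)"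
  proof (cases "i - j")
    case 0
    then show ?thesis using k by (simp add: ker_der_def binomial_eq_0 del: of_nat_mult)
  next
    case (Suc r)
    have "fact j * (i choose j) * Suc r = fact (Suc j) * (i choose Suc j)"
    proof -
      have "Suc r * (i choose j) = Suc j * (i choose Suc j)"
        using binomial_absorb_comp[of i j] binomial_absorption[of j i] unfolding Suc by metis
      then have "fact j * (Suc r * (i choose j)) = fact j * (Suc j * (i choose Suc j))" by metis
      then show ?thesis by (simp only: fact_Suc of_nat_id mult.assoc mult.commute mult.left_commute)
    qed
    then have "of_nat (fact (Suc j) * (i choose Suc j)) =
        (of_nat (fact j * (i choose j)) * of_nat (Suc r) :: ('a, 'b) mpoly)"
      by (metis of_nat_mult)
    moreover have "i - Suc j = r" using Suc by simp
    ultimately show ?thesis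
      unfolding Suc derivation_slice_power[OF assms(1,2) k] by (simp only: mult_ac)
  qed
  finally show ?case .
qed simp

section \<open>The exponential is a translation\<close>

lemma exp_derivation_eq_sum:
  assumes "derivation D" "(D ^^ m) b = 0"
  shows "exp_derivation a D b = (\<Sum>j<m. Const (1 / fact j) * a ^ j * (D ^^ j) b)"
proof -
  have van: "(D ^^ j) b = 0" if "\<not> j < m" for j
  proof -
    have "(D ^^ j) b = (D ^^ (j - m + m)) b" using that by simp
    also have "\<dots> = 0"
      unfolding funpow_add o_apply by (simp only: assms(2) funpow_derivation_zero[OF assms(1)])
    finally show ?thesis .
  qed
  show ?thesis
    unfolding exp_derivation_def
  proof (rule Sum_any.expand_superset)
    show "{j. Const (1 / fact j) * a ^ j * (D ^^ j) b \<noteq> 0} \<subseteq> {..<m}"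
    proof
      fix j
      assume "j \<in> {j. Const (1 / fact j) * a ^ j * (D ^^ j) b \<noteq> 0}"
      then show "j \<in> {..<m}" using van[of j] by (cases "j < m") simp_all
    qed
  qed simp
qed

text \<open>
  Finitely many elements are killed by a common power of \<open>D\<close>, so the exponential series on their
  span is one finite sum, which is linear term by term.
\<close>

lemma exp_derivation_sum:
  assumes "locally_nilpotent_derivation D" "finite I"
  shows "exp_derivation a D (sum f I) = (\<Sum>i\<in>I. exp_derivation a D (f i))"
proof -
  have der: "derivation D" and nil: "\<forall>b. \<exists>m. (D ^^ m) b = 0"
    using assms(1) by (auto simp: locally_nilpotent_derivation_def)
  obtain m where m: "\<And>b. (D ^^ m b) b = 0" using nil by metis
  define M where "M = (\<Sum>i\<in>I. m (f i))"
  have M: "(D ^^ M) (f i) = 0" if "i \<in> I" for i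
  proof -
    have "m (f i) \<le> M" unfolding M_def
      using member_le_sum[of i I "\<lambda>i. m (f i)"] assms(2) that by simp
    then have "(D ^^ M) (f i) = (D ^^ (M - m (f i) + m (f i))) (f i)" by simp
    also have "\<dots> = 0"
      unfolding funpow_add o_apply by (simp only: m funpow_derivation_zero[OF der])
    finally show ?thesis .
  qed
  have sum0: "(D ^^ M) (sum f I) = 0" by (simp add: funpow_derivation_sum[OF der] M)
  have "exp_derivation a D (sum f I)
      = (\<Sum>i\<in>I. \<Sum>j<M. Const (1 / fact j) * a ^ j * (D ^^ j) (f i))"
    unfolding exp_derivation_eq_sum[OF der sum0] funpow_derivation_sum[OF der] sum_distrib_left
    by (rule sum.swap)
  also have "\<dots> = (\<Sum>i\<in>I. exp_derivation a D (f i))"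
    by (rule sum.cong) (simp_all only: exp_derivation_eq_sum[OF der M])
  finally show ?thesis .
qed

text \<open>On a monomial in the slice, Taylor's formula is the binomial theorem.\<close>

lemma exp_derivation_slice_monomial:
  fixes D :: "('n, 'k::field_char_0) mpoly \<Rightarrow> ('n, 'k) mpoly"
  assumes "derivation D" "is_slice D s" "c \<in> ker_der D"
  shows "exp_derivation a D (c * s ^ i) = c * (s + a) ^ i"
proof -
  have "Const (1 / fact j) * a ^ j * (D ^^ j) (c * s ^ i)
      = c * (of_nat (i choose j) * a ^ j * s ^ (i - j))" for j
  proof -
    have "Const (1 / fact j :: 'k) * of_nat (fact j) = (1 :: ('n, 'k) mpoly)"
      unfolding Const_of_nat[symmetric] Const_mult by simp
    moreover have "Const (1 / fact j) * a ^ j * (D ^^ j) (c * s ^ i)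
        = (Const (1 / fact j) * of_nat (fact j)) * (c * (of_nat (i choose j) * a ^ j * s ^ (i - j)))"
      unfolding funpow_derivation_slice_monomial[OF assms] of_nat_mult
      by (simp only: mult.assoc mult.commute mult.left_commute)
    ultimately show ?thesis by simp
  qed
  then have "exp_derivation a D (c * s ^ i)
      = (\<Sum>j<Suc i. c * (of_nat (i choose j) * a ^ j * s ^ (i - j)))"
    by (simp only: exp_derivation_eq_sum[OF assms(1) funpow_derivation_slice_power(2)[OF assms]])
  then show ?thesis
    by (simp only: lessThan_Suc_atMost sum_distrib_left[symmetric] binomial_ring[symmetric]
        add.commute[of a])
qed

lemma exp_derivation_poly:
  fixes D :: "('n, 'k::field_char_0) mpoly \<Rightarrow> ('n, 'k) mpoly"
  assumes "locally_nilpotent_derivation D" "is_slice D s" "\<And>i. coeff P i \<in> ker_der D"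
  shows "exp_derivation a D (poly P s) = poly P (s + a)"
proof -
  have der: "derivation D" using assms(1) by (simp add: locally_nilpotent_derivation_def)
  show ?thesis
    by (simp add: poly_altdef exp_derivation_sum[OF assms(1)]
        exp_derivation_slice_monomial[OF der assms(2,3)])
qed

lemma is_slice_add_kernel:
  "derivation D \<Longrightarrow> is_slice D s \<Longrightarrow> a \<in> ker_der D \<Longrightarrow> is_slice D (s + a)"
  by (simp add: is_slice_def ker_der_def derivationD(1)[of D])

lemma exp_derivation_uminus:
  fixes D :: "('n, 'k::field_char_0) mpoly \<Rightarrow> ('n, 'k) mpoly"
  assumes "locally_nilpotent_derivation D" "is_slice D s" "a \<in> ker_der D"
  shows "exp_derivation (- a) D (exp_derivation a D b) = b"
proof -
  have der: "derivation D" using assms(1) by (simp add: locally_nilpotent_derivation_def)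
  obtain P where P: "\<And>i. coeff P i \<in> ker_der D" "b = poly P s"
    using kernel_poly_exists[OF assms(1,2)] by blast
  \<comment> \<open>The outer exponential is evaluated with respect to the slice \<open>s + a\<close>.\<close>
  show ?thesis
    unfolding P(2)
    by (simp add: exp_derivation_poly[OF assms(1,2) P(1)]
        exp_derivation_poly[OF assms(1) is_slice_add_kernel[OF der assms(2,3)] P(1)])
qed

lemma alg_aut_exp_derivation:
  fixes D :: "('n, 'k::field_char_0) mpoly \<Rightarrow> ('n, 'k) mpoly"
  assumes "locally_nilpotent_derivation D" "is_slice D s" "a \<in> ker_der D"
  shows "alg_aut (exp_derivation a D)"
  unfolding alg_aut_def
proof (intro conjI allI)
  have der: "derivation D" using assms(1) by (simp add: locally_nilpotent_derivation_def)
  note ex = kernel_poly_exists[OF assms(1,2)]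
  note e = exp_derivation_poly[OF assms(1,2)]
  show "bij (exp_derivation a D)"
    using exp_derivation_uminus[OF assms]
      exp_derivation_uminus[OF assms(1,2) ker_der_closed(3)[OF der assms(3)]]
    by (intro o_bij[of "exp_derivation (- a) D"]) (simp_all add: fun_eq_iff)
  show "exp_derivation a D (Const c) = Const c" for c
    using e[of "[:Const c:]"]
    by (simp add: coeff_pCons ker_der_def derivationD[OF der] split: nat.split)
  fix p q
  obtain P Q where P: "\<And>i. coeff P i \<in> ker_der D" "p = poly P s"
    and Q: "\<And>i. coeff Q i \<in> ker_der D" "q = poly Q s"
    using ex by metis
  note closed = ker_der_poly_closed(1,2)[OF der P(1) Q(1)]
  show "exp_derivation a D (p + q) = exp_derivation a D p + exp_derivation a D q"
    using e[OF closed(1)] by (simp add: P(2) Q(2) e[OF P(1)] e[OF Q(1)])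
  show "exp_derivation a D (p * q) = exp_derivation a D p * exp_derivation a D q"
    using e[OF closed(2)] by (simp add: P(2) Q(2) e[OF P(1)] e[OF Q(1)])
qed

section \<open>Changing the slice\<close>

lemma exp_derivation_intertwines:
  fixes D :: "('n, 'k::field_char_0) mpoly \<Rightarrow> ('n, 'k) mpoly"
  assumes "locally_nilpotent_derivation D" "is_slice D s" "a \<in> ker_der D"
  shows "exp_derivation a D (scaled_derivation N D s b)
    = scaled_derivation N D (s + a) (exp_derivation a D b)"
proof -
  have der: "derivation D" using assms(1) by (simp add: locally_nilpotent_derivation_def)
  obtain P where P: "\<And>i. coeff P i \<in> ker_der D" "b = poly P s"
    using kernel_poly_exists[OF assms(1,2)] by blast
  obtain Q where Q: "\<And>i. coeff Q i \<in> ker_der D"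
    and DQ: "\<And>u. is_slice D u \<Longrightarrow> D (poly P u) = poly Q u"
    using derivation_poly_slice[where P = P, OF der P(1)] by blast
  \<comment> \<open>\<open>R\<close> is \<open>N T P'(T)\<close>, so \<open>NuD\<close> sends \<open>P(u)\<close> to \<open>R(u)\<close> for every slice \<open>u\<close>.\<close>
  define R where "R = pCons 0 ([:of_int N:] * Q)"
  have R: "coeff R i \<in> ker_der D" for i
    unfolding R_def
    by (intro ker_der_poly_closed[OF der] ker_der_pCons_closed[OF der] Q ker_der_closed(7)[OF der])
      (simp_all add: ker_der_def derivationD[OF der])
  have at: "scaled_derivation N D u (poly P u) = poly R u" if "is_slice D u" for u
    using DQ[OF that] by (simp add: scaled_derivation_def R_def mult_ac)
  show ?thesis
    by (simp add: P(2) exp_derivation_poly[OF assms(1,2)] P(1) R at[OF assms(2)]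
        at[OF is_slice_add_kernel[OF der assms(2,3)]])
qed

lemma exp_derivation_conjugates:
  fixes D :: "('n, 'k::field_char_0) mpoly \<Rightarrow> ('n, 'k) mpoly"
  assumes "locally_nilpotent_derivation D" "is_slice D s" "a \<in> ker_der D"
  shows "exp_derivation a D \<circ> scaled_derivation N D s \<circ> inv (exp_derivation a D)
    = scaled_derivation N D (s + a)"
  using alg_aut_exp_derivation[OF assms]
  by (simp add: fun_eq_iff exp_derivation_intertwines[OF assms] alg_aut_def bij_is_surj surj_f_inv_f)

lemma alg_aut_comp: "alg_aut \<phi> \<Longrightarrow> alg_aut \<psi> \<Longrightarrow> alg_aut (\<phi> \<circ> \<psi>)"
  by (simp add: alg_aut_def bij_comp)

lemma gm_linearizable_shift_slice:
  fixes D :: "('n::finite, 'k::field_char_0) mpoly \<Rightarrow> ('n, 'k) mpoly"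
  assumes "N \<noteq> 0" "locally_nilpotent_derivation D" "is_slice D s" "a \<in> ker_der D"
    and "gm_linearizable (gm_action N D (s + a))"
  shows "gm_linearizable (gm_action N D s)"
proof -
  let ?e = "exp_derivation a D"
  have der: "derivation D" using assms(2) by (simp add: locally_nilpotent_derivation_def)
  note aut = alg_aut_exp_derivation[OF assms(2-4)]
  obtain \<phi> where \<phi>: "alg_aut \<phi>"
    and diag: "diagonal_linear (\<phi> \<circ> scaled_derivation N D (s + a) \<circ> inv \<phi>)"
    using assms(5) gm_linearizable_iff[OF assms(1,2) is_slice_add_kernel[OF der assms(3,4)]]
    by blast
  have "inv (\<phi> \<circ> ?e) = inv ?e \<circ> inv \<phi>"
    using aut \<phi> by (intro o_inv_distrib) (simp_all add: alg_aut_def)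
  then have "(\<phi> \<circ> ?e) \<circ> scaled_derivation N D s \<circ> inv (\<phi> \<circ> ?e)
      = \<phi> \<circ> scaled_derivation N D (s + a) \<circ> inv \<phi>"
    by (simp add: exp_derivation_conjugates[OF assms(2-4), symmetric] o_assoc)
  then show ?thesis
    using diag alg_aut_comp[OF \<phi> aut] gm_linearizable_iff[OF assms(1-3)] by metis
qed

theorem theorem6p1:
  fixes D :: "('n::finite, 'k::{alg_closed_field, field_char_0}) mpoly \<Rightarrow> ('n, 'k) mpoly"
    and N :: int and s s' a :: "('n, 'k) mpoly"
  assumes "locally_nilpotent_derivation D"
    and "N \<noteq> 0"
    and "a \<in> ker_der D"
    and "is_slice D s" and "is_slice D s'" and "s' = s + a"
  shows "alg_aut (exp_derivation a D)
    \<and> exp_derivation a D \<circ> scaled_derivation N D s \<circ> inv (exp_derivation a D) = scaled_derivation N D s'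
    \<and> (gm_linearizable (gm_action N D s) \<longleftrightarrow> gm_linearizable (gm_action N D s'))"
proof (intro conjI iffI)
  have der: "derivation D" using assms(1) by (simp add: locally_nilpotent_derivation_def)
  show "alg_aut (exp_derivation a D)"
    by (rule alg_aut_exp_derivation[OF assms(1,4,3)])
  show "exp_derivation a D \<circ> scaled_derivation N D s \<circ> inv (exp_derivation a D)
      = scaled_derivation N D s'"
    unfolding assms(6) by (rule exp_derivation_conjugates[OF assms(1,4,3)])
  show "gm_linearizable (gm_action N D s)" if "gm_linearizable (gm_action N D s')"
    using that gm_linearizable_shift_slice[OF assms(2,1,4,3)] unfolding assms(6) by blast
  \<comment> \<open>The converse uses \<open>s'\<close> as the slice and \<open>-a\<close> as the translation.\<close>
  have "s = s' + - a" by (simp add: assms(6))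
  then show "gm_linearizable (gm_action N D s')" if "gm_linearizable (gm_action N D s)"
    using that gm_linearizable_shift_slice[OF assms(2,1,5) ker_der_closed(3)[OF der assms(3)]]
    by metis
qed

end
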